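(* Let $f:\{0,1\}^4\to\mathbb{R}$ be submodular with polynomial representation $f(x_1,\dots,x_4)=\sum_{I\subseteq\{1,2,3,4\}}a_I\prod_{i\in I}x_i$. Then $f$ is expressible by $\Gamma_{\mathsf{sub},2}$ if and only if $f$ satisfies condition Sep: for all distinct $i,j,k,l\in\{1,2,3,4\}$, $a_{\{i,j\}}+a_{\{k,l\}}+a_{\{i,j,k\}}+a_{\{i,j,l\}}\le0$.
   Context: Every function $\{0,1\}^n\to\mathbb{R}$ has a unique representation as a multilinear polynomial $\sum_I a_I\prod_{i\in I}x_i$. A function $\phi:\{0,1\}^n\to\mathbb{R}$ is submodular if $\phi(\min(u,v))+\phi(\max(u,v))\le\phi(u)+\phi(v)$ for all $u,v$ (coordinatewise min/max). $\Gamma_{\mathsf{sub},2}$ is the set of real-valued submodular functions on $\{0,1\}$ of arity at most 2. $f$ is expressible by $\Gamma_{\mathsf{sub},2}$ if $f(x)=\min_{y_1,\dots,y_j\in\{0,1\}}\phi'(x,y)+\kappa$ for some $j\ge0$, constant $\kappa$, and $\phi'$ a nonnegative linear combination of functions from $\Gamma_{\mathsf{sub},2}$ each applied to some of the variables $x_1,\dots,x_4,y_1,\dots,y_j$. *)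

theory Defs
  imports Complex_Main
begin

text \<open>
  The cube $\{0,1\}^n$ is the set of Boolean lists of length $n$, with \<open>False < True\<close>
  standing for $0 < 1$; a function on it is a function on lists whose values at other lengths
  are irrelevant. Coordinates are numbered from 0, so the variables $x_1, \dots, x_n$ are
  \<open>x ! 0\<close>, \dots, \<open>x ! (n - 1)\<close>.
\<close>

definition cube :: "nat \<Rightarrow> bool list set" where
  "cube n = {x. length x = n}"

definition submodular :: "nat \<Rightarrow> (bool list \<Rightarrow> real) \<Rightarrow> bool" where
  "submodular n \<phi> \<longleftrightarrow>
     (\<forall>u\<in>cube n. \<forall>v\<in>cube n. \<phi> (map2 min u v) + \<phi> (map2 max u v) \<le> \<phi> u + \<phi> v)"

definition polynomial_representation ::
    "nat \<Rightarrow> (nat set \<Rightarrow> real) \<Rightarrow> (bool list \<Rightarrow> real) \<Rightarrow> bool" where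
  "polynomial_representation n a f \<longleftrightarrow>
     (\<forall>x\<in>cube n. f x = (\<Sum>I\<in>Pow {..<n}. a I * (\<Prod>i\<in>I. of_bool (x ! i))))"

text \<open>A set of functions of various arities is a set of pairs (arity, function).\<close>

definition Gamma_sub2 :: "(nat \<times> (bool list \<Rightarrow> real)) set" where
  "Gamma_sub2 = {(m, \<phi>). m \<le> 2 \<and> submodular m \<phi>}"

text \<open>
  The \<open>t\<close>-th summand applies \<open>g t\<close> to the variables listed in the scope \<open>s t\<close>; as usual for
  valued constraints, a scope may repeat a variable.
\<close>

definition nonneg_combination ::
    "(nat \<times> (bool list \<Rightarrow> real)) set \<Rightarrow> nat \<Rightarrow> (bool list \<Rightarrow> real) \<Rightarrow> bool" where
  "nonneg_combination \<Gamma> n \<phi> \<longleftrightarrow>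
     (\<exists>(N :: nat) (c :: nat \<Rightarrow> real) (g :: nat \<Rightarrow> bool list \<Rightarrow> real) (s :: nat \<Rightarrow> nat list).
        (\<forall>t<N. 0 \<le> c t \<and> (length (s t), g t) \<in> \<Gamma> \<and> set (s t) \<subseteq> {..<n}) \<and>
        (\<forall>z\<in>cube n. \<phi> z = (\<Sum>t<N. c t * g t (map ((!) z) (s t)))))"

definition expressible ::
    "(nat \<times> (bool list \<Rightarrow> real)) set \<Rightarrow> nat \<Rightarrow> (bool list \<Rightarrow> real) \<Rightarrow> bool" where
  "expressible \<Gamma> n f \<longleftrightarrow>
     (\<exists>(j :: nat) (\<kappa> :: real) (\<phi> :: bool list \<Rightarrow> real).
        nonneg_combination \<Gamma> (n + j) \<phi> \<and>
        (\<forall>x\<in>cube n. f x = Min ((\<lambda>y. \<phi> (x @ y)) ` cube j) + \<kappa>))"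

definition Sep :: "(nat set \<Rightarrow> real) \<Rightarrow> bool" where
  "Sep a \<longleftrightarrow>
     (\<forall>i\<in>{..<4}. \<forall>j\<in>{..<4}. \<forall>k\<in>{..<4}. \<forall>l\<in>{..<4}. distinct [i, j, k, l] \<longrightarrow>
        a {i, j} + a {k, l} + a {i, j, k} + a {i, j, l} \<le> 0)"

text \<open>The minimum in \<open>expressible\<close> is over a finite nonempty set.\<close>

lemma finite_cube: "finite (cube n)"
  using finite_lists_length_eq[of "UNIV :: bool set" n] by (simp add: cube_def)

lemma cube_nonempty: "cube n \<noteq> {}"
  unfolding cube_def using length_replicate[of n False] by blast

end

theory Submission
  imports Defs
begin

text \<open>
  Necessity: writing the separation inequality in terms of values of \<open>f\<close>, it says that \<open>f\<close> does not
  increase in total when the five sets \<open>ij, ik, jk, il, jl\<close> are replaced by \<open>ijk, ijl, i, j, kl\<close>.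
  This replacement extends to a map \<open>{0,1}\<^sup>5 \<rightarrow> {0,1}\<^sup>5\<close> that preserves weights and does not decrease
  inner products. Such a map does not increase totals of any binary submodular function, these being
  modular up to a term \<open>- c x y\<close> with \<open>c \<ge> 0\<close>; applied to minimising values of the hidden variables
  it yields the inequality for every expressible \<open>f\<close>.

  Sufficiency: up to a modular function, \<open>f\<close> is a nonnegative combination of functions expressible
  with at most two hidden variables. If the quartic coefficient is at most 0, then pairs, triple
  thresholds and \<open>- max 0 (\<Sum> x - 1)\<close>, \<open>- max 0 (\<Sum> x - 3)\<close> suffice. If it is at least 0, separation
  follows from submodularity, and the least admissible pair coefficients are piecewise linear in the
  higher ones; on each linearity domain \<open>f\<close> is interpolated from explicit corner functions.
\<close>

section \<open>Closure properties of expressibility\<close>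

lemma nonneg_combinationE:
  assumes "nonneg_combination \<Gamma> n \<phi>"
  obtains N :: nat and c :: "nat \<Rightarrow> real" and g :: "nat \<Rightarrow> bool list \<Rightarrow> real"
    and s :: "nat \<Rightarrow> nat list"
  where "\<And>t. t < N \<Longrightarrow> 0 \<le> c t \<and> (length (s t), g t) \<in> \<Gamma> \<and> set (s t) \<subseteq> {..<n}"
    and "\<And>z. z \<in> cube n \<Longrightarrow> \<phi> z = (\<Sum>t<N. c t * g t (map ((!) z) (s t)))"
  using assms unfolding nonneg_combination_def by (elim exE conjE) (rule that, simp_all)

lemma nonneg_combinationI:
  fixes N :: nat
  assumes "\<And>t. t < N \<Longrightarrow> 0 \<le> c t \<and> (length (s t), g t) \<in> \<Gamma> \<and> set (s t) \<subseteq> {..<n}"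
    and "\<And>z. z \<in> cube n \<Longrightarrow> \<phi> z = (\<Sum>t<N. c t * g t (map ((!) z) (s t)))"
  shows "nonneg_combination \<Gamma> n \<phi>"
  unfolding nonneg_combination_def
  by (rule exI[of _ N], rule exI[of _ c], rule exI[of _ g], rule exI[of _ s]) (use assms in simp)

lemma nonneg_combination_single:
  assumes "(length s, g) \<in> \<Gamma>" and "set s \<subseteq> {..<n}" and "0 \<le> c"
  shows "nonneg_combination \<Gamma> n (\<lambda>z. c * g (map ((!) z) s))"
  by (rule nonneg_combinationI[of 1 "\<lambda>_. c" "\<lambda>_. s" "\<lambda>_. g"]) (use assms in simp_all)

lemma nonneg_combination_add:
  assumes "nonneg_combination \<Gamma> n \<phi>" and "nonneg_combination \<Gamma> n \<psi>"
  shows "nonneg_combination \<Gamma> n (\<lambda>z. \<phi> z + \<psi> z)"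
proof -
  obtain N :: nat and c :: "nat \<Rightarrow> real" and g :: "nat \<Rightarrow> bool list \<Rightarrow> real"
    and s :: "nat \<Rightarrow> nat list" where 1: "\<And>t. t < N \<Longrightarrow> 0 \<le> c t \<and> (length (s t), g t) \<in> \<Gamma> \<and> set (s t) \<subseteq> {..<n}"
    "\<And>z. z \<in> cube n \<Longrightarrow> \<phi> z = (\<Sum>t<N. c t * g t (map ((!) z) (s t)))"
    using assms(1) by (rule nonneg_combinationE) (rule that)
  obtain N' :: nat and c' :: "nat \<Rightarrow> real" and g' :: "nat \<Rightarrow> bool list \<Rightarrow> real"
    and s' :: "nat \<Rightarrow> nat list" where 2: "\<And>t. t < N' \<Longrightarrow>
      0 \<le> c' t \<and> (length (s' t), g' t) \<in> \<Gamma> \<and> set (s' t) \<subseteq> {..<n}"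
    "\<And>z. z \<in> cube n \<Longrightarrow> \<psi> z = (\<Sum>t<N'. c' t * g' t (map ((!) z) (s' t)))"
    using assms(2) by (rule nonneg_combinationE) (rule that)
  define C where "C t = (if t < N then c t else c' (t - N))" for t
  define G where "G t = (if t < N then g t else g' (t - N))" for t
  define S where "S t = (if t < N then s t else s' (t - N))" for t
  have split: "(\<Sum>t<N+N'. h t) = (\<Sum>t<N. h t) + (\<Sum>t<N'. h (t + N))" for h :: "nat \<Rightarrow> real"
    by (simp add: lessThan_atLeast0 add.commute[of N N']
        sum.atLeastLessThan_concat[of 0 N "N' + N" h, symmetric]
        sum.shift_bounds_nat_ivl[of h 0 N N', simplified])
  show ?thesis
  proof (rule nonneg_combinationI[of "N + N'" C S G])
    show "0 \<le> C t \<and> (length (S t), G t) \<in> \<Gamma> \<and> set (S t) \<subseteq> {..<n}" if "t < N + N'" for t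
      using that 1(1) 2(1) by (auto simp: C_def G_def S_def)
    show "\<phi> z + \<psi> z = (\<Sum>t<N + N'. C t * G t (map ((!) z) (S t)))" if "z \<in> cube n" for z
      using 1(2) 2(2) that by (simp add: split C_def G_def S_def)
  qed
qed

lemma nonneg_combination_scale:
  assumes "nonneg_combination \<Gamma> n \<phi>" and "0 \<le> r"
  shows "nonneg_combination \<Gamma> n (\<lambda>z. r * \<phi> z)"
proof -
  obtain N :: nat and c :: "nat \<Rightarrow> real" and g :: "nat \<Rightarrow> bool list \<Rightarrow> real"
    and s :: "nat \<Rightarrow> nat list" where 1: "\<And>t. t < N \<Longrightarrow> 0 \<le> c t \<and> (length (s t), g t) \<in> \<Gamma> \<and> set (s t) \<subseteq> {..<n}"
    "\<And>z. z \<in> cube n \<Longrightarrow> \<phi> z = (\<Sum>t<N. c t * g t (map ((!) z) (s t)))"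
    using assms(1) by (rule nonneg_combinationE) (rule that)
  show ?thesis
    by (rule nonneg_combinationI[of N "\<lambda>t. r * c t" s g])
      (use 1 assms(2) in \<open>simp_all add: sum_distrib_left mult.assoc\<close>)
qed

lemma nonneg_combination_reindex:
  assumes "nonneg_combination \<Gamma> n \<phi>" and r: "\<And>i. i < n \<Longrightarrow> r i < m"
  shows "nonneg_combination \<Gamma> m (\<lambda>z. \<phi> (map (\<lambda>i. z ! r i) [0..<n]))"
proof -
  obtain N :: nat and c :: "nat \<Rightarrow> real" and g :: "nat \<Rightarrow> bool list \<Rightarrow> real"
    and s :: "nat \<Rightarrow> nat list" where 1: "\<And>t. t < N \<Longrightarrow> 0 \<le> c t \<and> (length (s t), g t) \<in> \<Gamma> \<and> set (s t) \<subseteq> {..<n}"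
    "\<And>z. z \<in> cube n \<Longrightarrow> \<phi> z = (\<Sum>t<N. c t * g t (map ((!) z) (s t)))"
    using assms(1) by (rule nonneg_combinationE) (rule that)
  have scope: "map ((!) (map (\<lambda>i. z ! r i) [0..<n])) (s t) = map ((!) z) (map r (s t))"
    if "t < N" for t z
    using 1(1) that by (auto simp: subset_eq)
  show ?thesis
  proof (rule nonneg_combinationI[of N c "\<lambda>t. map r (s t)" g])
    show "0 \<le> c t \<and> (length (map r (s t)), g t) \<in> \<Gamma> \<and> set (map r (s t)) \<subseteq> {..<m}" if "t < N" for t
      using 1(1)[OF that] r by (auto simp: subset_eq)
    show "\<phi> (map (\<lambda>i. z ! r i) [0..<n]) = (\<Sum>t<N. c t * g t (map ((!) z) (map r (s t))))" for z
    proof -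
      have "map (\<lambda>i. z ! r i) [0..<n] \<in> cube n"
        by (simp add: cube_def)
      from 1(2)[OF this] show ?thesis
        by (simp only:) (rule sum.cong[OF refl], simp only: scope lessThan_iff)
    qed
  qed
qed

lemma expressible_iff_attained:
  "expressible \<Gamma> n f \<longleftrightarrow>
     (\<exists>j \<kappa> \<phi>. nonneg_combination \<Gamma> (n + j) \<phi> \<and>
        (\<forall>x\<in>cube n. (\<exists>y\<in>cube j. f x = \<phi> (x @ y) + \<kappa>) \<and> (\<forall>y\<in>cube j. f x \<le> \<phi> (x @ y) + \<kappa>)))"
proof -
  have "f x = Min ((\<lambda>y. \<phi> (x @ y)) ` cube j) + \<kappa> \<longleftrightarrow>
      (\<exists>y\<in>cube j. f x = \<phi> (x @ y) + \<kappa>) \<and> (\<forall>y\<in>cube j. f x \<le> \<phi> (x @ y) + \<kappa>)"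
    for x \<phi> j and \<kappa> :: real
  proof -
    have "f x = Min ((\<lambda>y. \<phi> (x @ y)) ` cube j) + \<kappa> \<longleftrightarrow>
        Min ((\<lambda>y. \<phi> (x @ y)) ` cube j) = f x - \<kappa>"
      by auto
    also have "\<dots> \<longleftrightarrow> f x - \<kappa> \<in> (\<lambda>y. \<phi> (x @ y)) ` cube j \<and>
        (\<forall>a\<in>(\<lambda>y. \<phi> (x @ y)) ` cube j. f x - \<kappa> \<le> a)"
      by (rule Min_eq_iff) (auto simp: finite_cube cube_nonempty)
    also have "\<dots> \<longleftrightarrow>
      (\<exists>y\<in>cube j. f x = \<phi> (x @ y) + \<kappa>) \<and> (\<forall>y\<in>cube j. f x \<le> \<phi> (x @ y) + \<kappa>)"
      by (auto simp: image_iff algebra_simps)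
    finally show ?thesis .
  qed
  then show ?thesis
    unfolding expressible_def by simp
qed

lemma expressible_cong:
  assumes "expressible \<Gamma> n f" and "\<And>x. x \<in> cube n \<Longrightarrow> g x = f x"
  shows "expressible \<Gamma> n g"
  using assms unfolding expressible_def by simp

lemma expressible_scale:
  assumes "expressible \<Gamma> n f" and "0 \<le> r"
  shows "expressible \<Gamma> n (\<lambda>x. r * f x)"
proof -
  obtain j \<kappa> \<phi> where \<phi>: "nonneg_combination \<Gamma> (n + j) \<phi>"
    "\<forall>x\<in>cube n. (\<exists>y\<in>cube j. f x = \<phi> (x @ y) + \<kappa>) \<and> (\<forall>y\<in>cube j. f x \<le> \<phi> (x @ y) + \<kappa>)"
    using assms(1) unfolding expressible_iff_attained by blast
  show ?thesis
    unfolding expressible_iff_attained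
  proof (rule exI[of _ j], rule exI[of _ "r * \<kappa>"], rule exI[of _ "\<lambda>z. r * \<phi> z"],
      intro conjI ballI)
    show "nonneg_combination \<Gamma> (n + j) (\<lambda>z. r * \<phi> z)"
      using \<phi>(1) assms(2) by (rule nonneg_combination_scale)
  next
    fix x assume "x \<in> cube n"
    then obtain y where "y \<in> cube j" "f x = \<phi> (x @ y) + \<kappa>"
      using \<phi>(2) by blast
    then show "\<exists>y\<in>cube j. r * f x = r * \<phi> (x @ y) + r * \<kappa>"
      by (auto simp: algebra_simps)
  next
    fix x y assume "x \<in> cube n" "y \<in> cube j"
    then have "f x \<le> \<phi> (x @ y) + \<kappa>"
      using \<phi>(2) by blast
    then show "r * f x \<le> r * \<phi> (x @ y) + r * \<kappa>"
      using mult_left_mono[OF _ assms(2)] by (simp add: distrib_left[symmetric])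
  qed
qed

lemma expressible_add:
  assumes "expressible \<Gamma> n f" and "expressible \<Gamma> n f'"
  shows "expressible \<Gamma> n (\<lambda>x. f x + f' x)"
proof -
  obtain j \<kappa> \<phi> where \<phi>: "nonneg_combination \<Gamma> (n + j) \<phi>"
    "\<forall>x\<in>cube n. (\<exists>y\<in>cube j. f x = \<phi> (x @ y) + \<kappa>) \<and> (\<forall>y\<in>cube j. f x \<le> \<phi> (x @ y) + \<kappa>)"
    using assms(1) unfolding expressible_iff_attained by blast
  obtain j' \<kappa>' \<phi>' where \<phi>': "nonneg_combination \<Gamma> (n + j') \<phi>'"
    "\<forall>x\<in>cube n. (\<exists>y\<in>cube j'. f' x = \<phi>' (x @ y) + \<kappa>') \<and>
       (\<forall>y\<in>cube j'. f' x \<le> \<phi>' (x @ y) + \<kappa>')"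
    using assms(2) unfolding expressible_iff_attained by blast
  define r where "r i = (if i < n then i else i + j)" for i
  define \<Phi> where "\<Phi> z = \<phi> (map (\<lambda>i. z ! i) [0..<n + j]) + \<phi>' (map (\<lambda>i. z ! r i) [0..<n + j'])"
    for z
  have \<Phi>: "\<Phi> (x @ y @ y') = \<phi> (x @ y) + \<phi>' (x @ y')"
    if "x \<in> cube n" "y \<in> cube j" "y' \<in> cube j'" for x y y'
  proof -
    have "map (\<lambda>i. (x @ y @ y') ! i) [0..<n + j] = x @ y"
      using that by (intro nth_equalityI) (auto simp: cube_def nth_append)
    moreover have "map (\<lambda>i. (x @ y @ y') ! r i) [0..<n + j'] = x @ y'"
      using that by (intro nth_equalityI) (auto simp: cube_def nth_append r_def)
    ultimately show ?thesis
      by (simp add: \<Phi>_def)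
  qed
  have comb: "nonneg_combination \<Gamma> (n + (j + j')) \<Phi>"
    unfolding \<Phi>_def
    by (rule nonneg_combination_add; rule nonneg_combination_reindex)
      (use \<phi>(1) \<phi>'(1) in \<open>auto simp: r_def\<close>)
  show ?thesis
    unfolding expressible_iff_attained
  proof (rule exI[of _ "j + j'"], rule exI[of _ "\<kappa> + \<kappa>'"], rule exI[of _ \<Phi>], intro conjI ballI)
    show "nonneg_combination \<Gamma> (n + (j + j')) \<Phi>" by (rule comb)
  next
    fix x assume x: "x \<in> cube n"
    then obtain y y' where "y \<in> cube j" "f x = \<phi> (x @ y) + \<kappa>"
      "y' \<in> cube j'" "f' x = \<phi>' (x @ y') + \<kappa>'"
      using \<phi>(2) \<phi>'(2) by blast
    then have "y @ y' \<in> cube (j + j')" "f x + f' x = \<Phi> (x @ y @ y') + (\<kappa> + \<kappa>')"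
      using x by (auto simp: \<Phi> cube_def)
    then show "\<exists>y\<in>cube (j + j'). f x + f' x = \<Phi> (x @ y) + (\<kappa> + \<kappa>')"
      by blast
  next
    fix x w assume x: "x \<in> cube n" and w: "w \<in> cube (j + j')"
    define y y' where "y = take j w" and "y' = drop j w"
    have y: "y \<in> cube j" "y' \<in> cube j'" "w = y @ y'"
      using w by (auto simp: cube_def y_def y'_def)
    then have "f x \<le> \<phi> (x @ y) + \<kappa>" "f' x \<le> \<phi>' (x @ y') + \<kappa>'"
      using x \<phi>(2) \<phi>'(2) by blast+
    then show "f x + f' x \<le> \<Phi> (x @ w) + (\<kappa> + \<kappa>')"
      using x y by (simp add: \<Phi>)
  qed
qed

lemma cube_2: "cube 2 = {[False, False], [True, False], [False, True], [True, True]}"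
  by (auto simp: cube_def numeral_2_eq_2 length_Suc_conv)

lemma expressible_min2:
  assumes "nonneg_combination \<Gamma> (n + 2) \<phi>"
  shows "expressible \<Gamma> n (\<lambda>x. min (min (\<phi> (x @ [False, False])) (\<phi> (x @ [True, False])))
    (min (\<phi> (x @ [False, True])) (\<phi> (x @ [True, True]))))"
proof -
  show ?thesis
    unfolding expressible_iff_attained
    by (rule exI[of _ 2], rule exI[of _ 0], rule exI[of _ \<phi>])
      (use assms in \<open>auto simp: cube_2 min_def\<close>)
qed

section \<open>Binary submodular gadgets\<close>

abbreviation coord :: "bool list \<Rightarrow> nat \<Rightarrow> real" where
  "coord z i \<equiv> of_bool (z ! i)"

lemma unary_in_Gamma_sub2: "(Suc 0, g) \<in> Gamma_sub2"
proof -
  have "cube (Suc 0) = {[False], [True]}"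
    by (auto simp: cube_def length_Suc_conv)
  then show ?thesis
    by (simp add: Gamma_sub2_def submodular_def)
qed

lemma binary_in_Gamma_sub2_iff:
  "(2, g) \<in> Gamma_sub2 \<longleftrightarrow> g [False, False] + g [True, True] \<le> g [False, True] + g [True, False]"
  by (auto simp: Gamma_sub2_def submodular_def cube_2)

lemma nonneg_combination_const:
  "nonneg_combination Gamma_sub2 n (\<lambda>z. r)"
proof -
  have "(length ([] :: nat list), \<lambda>_ :: bool list. r) \<in> Gamma_sub2"
    by (simp add: Gamma_sub2_def submodular_def)
  from nonneg_combination_single[OF this, of n 1] show ?thesis by simp
qed

lemma nonneg_combination_linear:
  assumes "i < n"
  shows "nonneg_combination Gamma_sub2 n (\<lambda>z. r * coord z i)"
proof -
  have "(length [i], \<lambda>u. r * coord u 0) \<in> Gamma_sub2"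
    by (simp add: unary_in_Gamma_sub2)
  from nonneg_combination_single[OF this, of n 1] assms show ?thesis by simp
qed

lemma nonneg_combination_product:
  assumes "i < n" and "j < n" and "0 \<le> r"
  shows "nonneg_combination Gamma_sub2 n (\<lambda>z. - r * coord z i * coord z j)"
proof -
  have "(length [i, j], \<lambda>u. - coord u 0 * coord u 1) \<in> Gamma_sub2"
    by (simp add: binary_in_Gamma_sub2_iff[unfolded numeral_2_eq_2])
  from nonneg_combination_single[OF this, of n r] assms show ?thesis
    by (simp add: mult.assoc)
qed

lemma expressible_modular:
  "expressible Gamma_sub2 4 (\<lambda>x. r + r0 * coord x 0 + r1 * coord x 1 + r2 * coord x 2 + r3 * coord x 3)"
  unfolding expressible_iff_attained
  by (rule exI[of _ 0], rule exI[of _ 0],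
      rule exI[of _ "\<lambda>x. r + r0 * coord x 0 + r1 * coord x 1 + r2 * coord x 2 + r3 * coord x 3"])
    (auto simp: cube_def intro!: nonneg_combination_add nonneg_combination_const
      nonneg_combination_linear)

text \<open>The hidden variables \<open>w\<close>, \<open>v\<close> contribute
  \<open>\<alpha> w + \<beta> v - \<gamma> w v - (\<Sum> c\<^sub>i x\<^sub>i) w - (\<Sum> d\<^sub>i x\<^sub>i) v\<close>.\<close>

lemma expressible_gadget:
  assumes "i < 4" "j < 4" "k < 4" "l < 4" and "0 \<le> \<gamma>"
    and "0 \<le> ci" "0 \<le> cj" "0 \<le> ck" "0 \<le> cl" and "0 \<le> di" "0 \<le> dj" "0 \<le> dk" "0 \<le> dl"
  shows "expressible Gamma_sub2 4 (\<lambda>x.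
    let C = ci * coord x i + cj * coord x j + ck * coord x k + cl * coord x l;
        D = di * coord x i + dj * coord x j + dk * coord x k + dl * coord x l
    in min (min 0 (\<alpha> - C)) (min (\<beta> - D) (\<alpha> + \<beta> - \<gamma> - C - D)))"
proof -
  define \<phi> where "\<phi> z = \<alpha> * coord z 4 + \<beta> * coord z 5 + - \<gamma> * coord z 4 * coord z 5
    + - ci * coord z i * coord z 4 + - cj * coord z j * coord z 4
    + - ck * coord z k * coord z 4 + - cl * coord z l * coord z 4
    + - di * coord z i * coord z 5 + - dj * coord z j * coord z 5
    + - dk * coord z k * coord z 5 + - dl * coord z l * coord z 5" for z
  have "nonneg_combination Gamma_sub2 (4 + 2) \<phi>"
    unfolding \<phi>_def using assms
    by (intro nonneg_combination_add nonneg_combination_linear nonneg_combination_product) auto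
  from expressible_min2[OF this] show ?thesis
    by (rule expressible_cong)
      (use assms in \<open>simp add: \<phi>_def cube_def nth_append Let_def algebra_simps\<close>)
qed

section \<open>Sufficiency\<close>

text \<open>The coefficient \<open>qij\<close> belongs to the pair complementary to \<open>{i, j}\<close>, and \<open>bi\<close> to the triple
  omitting \<open>i\<close>. Submodularity then reads \<open>max {0, bi, bj, bi + bj + A} \<le> qij\<close>, and the separation
  condition \<open>bi + bj \<le> qij + qkl\<close>.\<close>

definition quartic ::
  "nat \<Rightarrow> nat \<Rightarrow> nat \<Rightarrow> nat \<Rightarrow> real \<Rightarrow> real \<Rightarrow> real \<Rightarrow> real \<Rightarrow> real \<Rightarrow> real \<Rightarrow>
    real \<Rightarrow> real \<Rightarrow> real \<Rightarrow> real \<Rightarrow> real \<Rightarrow> bool list \<Rightarrow> real"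
where
  "quartic i j k l qij qik qil qjk qjl qkl bi bj bk bl A x =
     - qij * coord x k * coord x l - qik * coord x j * coord x l - qil * coord x j * coord x k
     - qjk * coord x i * coord x l - qjl * coord x i * coord x k - qkl * coord x i * coord x j
     + bi * coord x j * coord x k * coord x l + bj * coord x i * coord x k * coord x l
     + bk * coord x i * coord x j * coord x l + bl * coord x i * coord x j * coord x k
     + A * coord x i * coord x j * coord x k * coord x l"

context
  fixes i j k l :: nat
  assumes idx: "i < 4" "j < 4" "k < 4" "l < 4"
begin

abbreviation expressible4 where
  "expressible4 qij qik qil qjk qjl qkl bi bj bk bl A \<equiv>
     expressible Gamma_sub2 4 (quartic i j k l qij qik qil qjk qjl qkl bi bj bk bl A)"

lemma quartic_add:
  assumes "expressible4 qij qik qil qjk qjl qkl bi bj bk bl A"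
    and "expressible4 qij' qik' qil' qjk' qjl' qkl' bi' bj' bk' bl' A'"
  shows "expressible4 (qij + qij') (qik + qik') (qil + qil') (qjk + qjk') (qjl + qjl') (qkl + qkl')
    (bi + bi') (bj + bj') (bk + bk') (bl + bl') (A + A')"
  using expressible_add[OF assms]
  by (rule expressible_cong) (simp add: quartic_def algebra_simps)

lemma quartic_scale:
  assumes "expressible4 qij qik qil qjk qjl qkl bi bj bk bl A" and "0 \<le> r"
  shows "expressible4 (r * qij) (r * qik) (r * qil) (r * qjk) (r * qjl) (r * qkl)
    (r * bi) (r * bj) (r * bk) (r * bl) (r * A)"
  using expressible_scale[OF assms]
  by (rule expressible_cong) (simp add: quartic_def algebra_simps)

lemma quartic_gadget:
  assumes "0 \<le> \<gamma>"
    and "0 \<le> ci" "0 \<le> cj" "0 \<le> ck" "0 \<le> cl" and "0 \<le> di" "0 \<le> dj" "0 \<le> dk" "0 \<le> dl"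
    and "\<And>x. quartic i j k l qij qik qil qjk qjl qkl bi bj bk bl A x =
    (let C = ci * coord x i + cj * coord x j + ck * coord x k + cl * coord x l;
        D = di * coord x i + dj * coord x j + dk * coord x k + dl * coord x l
    in min (min 0 (\<alpha> - C)) (min (\<beta> - D) (\<alpha> + \<beta> - \<gamma> - C - D)))"
  shows "expressible4 qij qik qil qjk qjl qkl bi bj bk bl A"
  by (rule expressible_cong[OF expressible_gadget[OF idx assms(1-9)]]) (rule assms(10))

lemma quartic_threshold:
  assumes "0 \<le> ci" "0 \<le> cj" "0 \<le> ck" "0 \<le> cl"
    and "\<And>x. quartic i j k l qij qik qil qjk qjl qkl bi bj bk bl A x =
      min 0 (\<alpha> - (ci * coord x i + cj * coord x j + ck * coord x k + cl * coord x l))"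
  shows "expressible4 qij qik qil qjk qjl qkl bi bj bk bl A"
  by (rule quartic_gadget[of 0 ci cj ck cl 0 0 0 0 _ _ _ _ _ _ _ _ _ _ _ \<alpha> 0])
    (use assms in simp_all)

lemma threshold1: "expressible4 1 1 1 1 1 1 1 1 1 1 (-1)"
  by (rule quartic_threshold[of 1 1 1 1 _ _ _ _ _ _ _ _ _ _ _ 1]) (auto simp: quartic_def)

lemma threshold2: "expressible4 0 0 0 0 0 0 (-1) (-1) (-1) (-1) 2"
  by (rule quartic_threshold[of 1 1 1 1 _ _ _ _ _ _ _ _ _ _ _ 2]) (auto simp: quartic_def)

lemma threshold3: "expressible4 0 0 0 0 0 0 0 0 0 0 (-1)"
  by (rule quartic_threshold[of 1 1 1 1 _ _ _ _ _ _ _ _ _ _ _ 3]) (auto simp: quartic_def)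

lemma triple_threshold1:
  "expressible4 1 1 1 0 0 0 1 0 0 0 0" "expressible4 1 0 0 1 1 0 0 1 0 0 0"
  "expressible4 0 1 0 1 0 1 0 0 1 0 0" "expressible4 0 0 1 0 1 1 0 0 0 1 0"
  by (rule quartic_threshold[of 0 1 1 1 _ _ _ _ _ _ _ _ _ _ _ 1]
      quartic_threshold[of 1 0 1 1 _ _ _ _ _ _ _ _ _ _ _ 1]
      quartic_threshold[of 1 1 0 1 _ _ _ _ _ _ _ _ _ _ _ 1]
      quartic_threshold[of 1 1 1 0 _ _ _ _ _ _ _ _ _ _ _ 1]; auto simp: quartic_def; fail)+

lemma triple_threshold2:
  "expressible4 0 0 0 0 0 0 (-1) 0 0 0 0" "expressible4 0 0 0 0 0 0 0 (-1) 0 0 0"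
  "expressible4 0 0 0 0 0 0 0 0 (-1) 0 0" "expressible4 0 0 0 0 0 0 0 0 0 (-1) 0"
  by (rule quartic_threshold[of 0 1 1 1 _ _ _ _ _ _ _ _ _ _ _ 2], auto simp: quartic_def)
    (rule quartic_threshold[of 1 0 1 1 _ _ _ _ _ _ _ _ _ _ _ 2], auto simp: quartic_def,
     rule quartic_threshold[of 1 1 0 1 _ _ _ _ _ _ _ _ _ _ _ 2], auto simp: quartic_def,
     rule quartic_threshold[of 1 1 1 0 _ _ _ _ _ _ _ _ _ _ _ 2], auto simp: quartic_def)

lemma corner1000: "expressible4 0 0 0 0 0 0 0 (-1) (-1) (-1) 1"
  by (rule quartic_threshold[of 2 1 1 1 _ _ _ _ _ _ _ _ _ _ _ 3]) (auto simp: quartic_def)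

lemma corner0111: "expressible4 0 0 0 1 1 1 (-1) 0 0 0 1"
  by (rule quartic_threshold[of 2 1 1 1 _ _ _ _ _ _ _ _ _ _ _ 2]) (auto simp: quartic_def)

lemma corner1100: "expressible4 1 0 0 0 0 0 0 0 (-1) (-1) 1"
  by (rule quartic_gadget[of 1 0 0 1 1 1 1 0 0 _ _ _ _ _ _ _ _ _ _ _ 1 2])
    (auto simp: quartic_def)

lemma pair_product:
  "expressible4 1 0 0 0 0 0 0 0 0 0 0" "expressible4 0 1 0 0 0 0 0 0 0 0 0" "expressible4 0 0 1 0 0 0 0 0 0 0 0"
  "expressible4 0 0 0 1 0 0 0 0 0 0 0" "expressible4 0 0 0 0 1 0 0 0 0 0 0" "expressible4 0 0 0 0 0 1 0 0 0 0 0"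
  by (rule quartic_threshold[of 0 0 1 1 _ _ _ _ _ _ _ _ _ _ _ 1]
      quartic_threshold[of 0 1 0 1 _ _ _ _ _ _ _ _ _ _ _ 1]
      quartic_threshold[of 0 1 1 0 _ _ _ _ _ _ _ _ _ _ _ 1]
      quartic_threshold[of 1 0 0 1 _ _ _ _ _ _ _ _ _ _ _ 1]
      quartic_threshold[of 1 0 1 0 _ _ _ _ _ _ _ _ _ _ _ 1]
      quartic_threshold[of 1 1 0 0 _ _ _ _ _ _ _ _ _ _ _ 1]; auto simp: quartic_def; fail)+

lemma quartic_mono:
  assumes "expressible4 qij qik qil qjk qjl qkl bi bj bk bl A"
    and "qij \<le> qij'" "qik \<le> qik'" "qil \<le> qil'" "qjk \<le> qjk'" "qjl \<le> qjl'" "qkl \<le> qkl'"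
    and "bi = bi'" "bj = bj'" "bk = bk'" "bl = bl'" "A = A'"
  shows "expressible4 qij' qik' qil' qjk' qjl' qkl' bi' bj' bk' bl' A'"
proof -
  note pp = pair_product[THEN quartic_scale]
  have "expressible4 (qij' - qij) (qik' - qik) (qil' - qil) (qjk' - qjk) (qjl' - qjl) (qkl' - qkl) 0 0 0 0 0"
    using quartic_add[OF pp(1) quartic_add[OF pp(2) quartic_add[OF pp(3)
          quartic_add[OF pp(4) quartic_add[OF pp(5) pp(6)]]]],
        of "qij' - qij" "qik' - qik" "qil' - qil" "qjk' - qjk" "qjl' - qjl" "qkl' - qkl"]
      assms(2-7) by simp
  from quartic_add[OF assms(1) this] show ?thesis
    using assms(8-12) by simp
qed

lemma quartic_triples:
  assumes "0 \<le> ri" "0 \<le> rj" "0 \<le> rk" "0 \<le> rl" and "0 \<le> si" "0 \<le> sj" "0 \<le> sk" "0 \<le> sl"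
  shows "expressible4 (ri + rj) (ri + rk) (ri + rl) (rj + rk) (rj + rl) (rk + rl)
    (ri - si) (rj - sj) (rk - sk) (rl - sl) 0"
proof -
  note t1 = triple_threshold1[THEN quartic_scale] and t2 = triple_threshold2[THEN quartic_scale]
  have "expressible4 (ri + rj) (ri + rk) (ri + rl) (rj + rk) (rj + rl) (rk + rl) ri rj rk rl 0"
    using quartic_add[OF t1(1) quartic_add[OF t1(2) quartic_add[OF t1(3) t1(4)]], of ri rj rk rl]
      assms(1-4) by (simp add: add.commute)
  moreover have "expressible4 0 0 0 0 0 0 (- si) (- sj) (- sk) (- sl) 0"
    using quartic_add[OF t2(1) quartic_add[OF t2(2) quartic_add[OF t2(3) t2(4)]], of si sj sk sl]
      assms(5-8) by simp
  ultimately show ?thesis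
    using quartic_add by fastforce
qed

text \<open>The scale \<open>\<alpha>\<close> of the first threshold is constrained to an interval whose endpoints are
  compared by exactly the submodularity and separation inequalities.\<close>

lemma expressible_quartic_nonpos:
  assumes "A \<le> 0"
    and "0 \<le> qij" "0 \<le> qik" "0 \<le> qil" "0 \<le> qjk" "0 \<le> qjl" "0 \<le> qkl"
    and "bi \<le> qij" "bi \<le> qik" "bi \<le> qil" "bj \<le> qij" "bj \<le> qjk" "bj \<le> qjl"
    and "bk \<le> qik" "bk \<le> qjk" "bk \<le> qkl" "bl \<le> qil" "bl \<le> qjl" "bl \<le> qkl"
    and "bi + bj + A \<le> qij" "bi + bk + A \<le> qik" "bi + bl + A \<le> qil"
    and "bj + bk + A \<le> qjk" "bj + bl + A \<le> qjl" "bk + bl + A \<le> qkl"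
    and "bi + bj \<le> qij + qkl" "bk + bl \<le> qij + qkl" "bi + bk \<le> qik + qjl" "bj + bl \<le> qik + qjl"
    and "bi + bl \<le> qil + qjk" "bj + bk \<le> qil + qjk"
  shows "expressible4 qij qik qil qjk qjl qkl bi bj bk bl A"
proof -
  define \<alpha> where "\<alpha> = Max {0, bi + bj - qij, bi + bk - qik, bi + bl - qil,
    bj + bk - qjk, bj + bl - qjl, bk + bl - qkl}"
  have lower: "0 \<le> \<alpha>" "bi + bj - qij \<le> \<alpha>" "bi + bk - qik \<le> \<alpha>" "bi + bl - qil \<le> \<alpha>"
    "bj + bk - qjk \<le> \<alpha>" "bj + bl - qjl \<le> \<alpha>" "bk + bl - qkl \<le> \<alpha>"
    unfolding \<alpha>_def by (rule Max_ge; simp)+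
  have upper: "\<alpha> \<le> - A" "\<alpha> \<le> qij" "\<alpha> \<le> qik" "\<alpha> \<le> qil" "\<alpha> \<le> qjk" "\<alpha> \<le> qjl" "\<alpha> \<le> qkl"
    unfolding \<alpha>_def by (subst Max_le_iff; use assms in auto)+
  define pos :: "real \<Rightarrow> real" where "pos t = max 0 t" for t
  have nonneg: "0 \<le> pos t" for t by (simp add: pos_def)
  have pos: "pos (b - \<alpha>) - pos (\<alpha> - b) = b - \<alpha>" for b by (simp add: pos_def)
  have "expressible4 \<alpha> \<alpha> \<alpha> \<alpha> \<alpha> \<alpha> \<alpha> \<alpha> \<alpha> \<alpha> A"
    using quartic_add[OF quartic_scale[OF threshold1, of \<alpha>] quartic_scale[OF threshold3, of "- A - \<alpha>"]]
      lower(1) upper(1) by simp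
  note quartic_add[OF this quartic_triples[of "pos (bi - \<alpha>)" "pos (bj - \<alpha>)" "pos (bk - \<alpha>)"
        "pos (bl - \<alpha>)" "pos (\<alpha> - bi)" "pos (\<alpha> - bj)" "pos (\<alpha> - bk)" "pos (\<alpha> - bl)",
        OF nonneg nonneg nonneg nonneg nonneg nonneg nonneg nonneg]]
  then show ?thesis
  proof (rule quartic_mono)
  qed (use assms lower upper in \<open>simp_all add: pos\<close>, auto simp: pos_def max_def)
qed

end

text \<open>The corners of the cube \<open>-1 \<le> b \<le> 0\<close> at \<open>A = 1\<close>, where \<open>qij\<close> takes its least value
  \<open>max 0 (bi + bj + 1)\<close>.\<close>

lemma corner:
  assumes idx: "i < 4" "j < 4" "k < 4" "l < 4"
    and "ei \<in> {0, 1}" "ej \<in> {0, 1}" "ek \<in> {0, 1}" "el \<in> {0, 1}"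
  shows "expressible4 i j k l (ei * ej) (ei * ek) (ei * el) (ej * ek) (ej * el) (ek * el)
    (ei - 1) (ej - 1) (ek - 1) (el - 1) 1"
proof -
  have "expressible4 i j k l 1 1 1 1 1 1 0 0 0 0 1"
    using quartic_add[OF idx threshold1[OF idx] threshold2[OF idx]] by simp
  moreover have "expressible4 i j k l 0 0 0 0 0 0 (-1) (-1) (-1) (-1) 1"
    using quartic_add[OF idx threshold2[OF idx] threshold3[OF idx]] by simp
  moreover have "expressible4 i j k l 0 0 0 0 0 0 0 (-1) (-1) (-1) 1" "expressible4 i j k l 0 0 0 0 0 0 (-1) 0 (-1) (-1) 1"
    "expressible4 i j k l 0 0 0 0 0 0 (-1) (-1) 0 (-1) 1" "expressible4 i j k l 0 0 0 0 0 0 (-1) (-1) (-1) 0 1"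
    by (rule corner1000[OF idx(1,2,3,4), THEN expressible_cong]
        corner1000[OF idx(2,1,3,4), THEN expressible_cong]
        corner1000[OF idx(3,1,2,4), THEN expressible_cong]
        corner1000[OF idx(4,1,2,3), THEN expressible_cong]; auto simp: quartic_def; fail)+
  moreover have "expressible4 i j k l 0 0 0 1 1 1 (-1) 0 0 0 1" "expressible4 i j k l 0 1 1 0 0 1 0 (-1) 0 0 1"
    "expressible4 i j k l 1 0 1 0 1 0 0 0 (-1) 0 1" "expressible4 i j k l 1 1 0 1 0 0 0 0 0 (-1) 1"
    by (rule corner0111[OF idx(1,2,3,4), THEN expressible_cong]
        corner0111[OF idx(2,1,3,4), THEN expressible_cong]
        corner0111[OF idx(3,1,2,4), THEN expressible_cong]
        corner0111[OF idx(4,1,2,3), THEN expressible_cong]; auto simp: quartic_def; fail)+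
  moreover have "expressible4 i j k l 1 0 0 0 0 0 0 0 (-1) (-1) 1" "expressible4 i j k l 0 1 0 0 0 0 0 (-1) 0 (-1) 1"
    "expressible4 i j k l 0 0 1 0 0 0 0 (-1) (-1) 0 1" "expressible4 i j k l 0 0 0 1 0 0 (-1) 0 0 (-1) 1"
    "expressible4 i j k l 0 0 0 0 1 0 (-1) 0 (-1) 0 1" "expressible4 i j k l 0 0 0 0 0 1 (-1) (-1) 0 0 1"
    by (rule corner1100[OF idx(1,2,3,4), THEN expressible_cong]
        corner1100[OF idx(1,3,2,4), THEN expressible_cong]
        corner1100[OF idx(1,4,2,3), THEN expressible_cong]
        corner1100[OF idx(2,3,1,4), THEN expressible_cong]
        corner1100[OF idx(2,4,1,3), THEN expressible_cong]
        corner1100[OF idx(3,4,1,2), THEN expressible_cong]; auto simp: quartic_def; fail)+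
  ultimately show ?thesis
    using assms(5-8) by auto
qed

text \<open>With \<open>u = b + A / 2\<close>, the two largest \<open>\<bar>u\<bar>\<close> are made equal to \<open>m\<close> by a triple threshold,
  \<open>A\<close> is lowered to \<open>2 m\<close> by the middle threshold, and what remains interpolates the corners
  linearly on the two triangles into which the line \<open>u\<^sub>k + u\<^sub>l = 0\<close> cuts the square
  \<open>[-m, m]\<^sup>2\<close>.\<close>

lemma expressible_quartic_sorted:
  fixes ui uj uk ul A :: real
  assumes idx: "i < 4" "j < 4" "k < 4" "l < 4"
    and sorted: "\<bar>uj\<bar> \<le> \<bar>ui\<bar>" "\<bar>uk\<bar> \<le> \<bar>uj\<bar>" "\<bar>ul\<bar> \<le> \<bar>uj\<bar>" and A: "\<bar>ui\<bar> \<le> A / 2"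
    and q: "0 \<le> qij" "0 \<le> qik" "0 \<le> qil" "0 \<le> qjk" "0 \<le> qjl" "0 \<le> qkl"
      "ui + uj \<le> qij" "ui + uk \<le> qik" "ui + ul \<le> qil"
      "uj + uk \<le> qjk" "uj + ul \<le> qjl" "uk + ul \<le> qkl"
  shows "expressible4 i j k l qij qik qil qjk qjl qkl (ui - A / 2) (uj - A / 2) (uk - A / 2) (ul - A / 2) A"
proof -
  note add = quartic_add[OF idx] and scale = quartic_scale[OF idx] and corner = corner[OF idx]
  define m where "m = \<bar>uj\<bar>"
  define ei ej :: real where "ei = of_bool (0 \<le> ui)" and "ej = of_bool (0 \<le> uj)"
  have e: "ei \<in> {0, 1}" "ej \<in> {0, 1}"
    by (simp_all add: ei_def ej_def)
  define h where "h = (\<lambda>w11 w10 w01 w00 :: real.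
    expressible4 i j k l (2 * m * ei * ej) ((w11 + w10) * ei) ((w11 + w01) * ei) ((w11 + w10) * ej)
      ((w11 + w01) * ej) w11 (2 * m * (ei - 1)) (2 * m * (ej - 1)) (- w01 - w00) (- w10 - w00) (2 * m))"
  have h: "h w11 w10 w01 w00"
    if "0 \<le> w11" "0 \<le> w10" "0 \<le> w01" "0 \<le> w00" "w11 + w10 + w01 + w00 = 2 * m" for w11 w10 w01 w00
    unfolding h_def that(5)[symmetric]
    by (rule quartic_mono[OF idx add[OF scale[OF corner[of ei ej 1 1] that(1)]
          add[OF scale[OF corner[of ei ej 1 0] that(2)]
          add[OF scale[OF corner[of ei ej 0 1] that(3)] scale[OF corner[of ei ej 0 0] that(4)]]]]])
      (use e in \<open>auto simp: algebra_simps\<close>)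
  define d where "d = \<bar>ui\<bar> - m"
  have d: "0 \<le> d" and mid: "0 \<le> A / 2 - m"
    using sorted A by (simp_all add: d_def m_def)
  have base: "expressible4 i j k l (d * ei) (d * ei) (d * ei) 0 0 0 (d * (2 * ei - 1) - (A / 2 - m))
      (- (A / 2 - m)) (- (A / 2 - m)) (- (A / 2 - m)) (A - 2 * m)"
    by (rule quartic_mono[OF idx add[OF quartic_triples[OF idx, of "d * ei" 0 0 0 "d * (1 - ei)" 0 0 0]
          scale[OF threshold2[OF idx] mid]]])
      (use e d in \<open>auto simp: algebra_simps\<close>)
  show ?thesis
  proof (cases "0 \<le> uk + ul")
    case True
    have "h (uk + ul) (m - ul) (m - uk) 0"
      by (rule h) (use True sorted in \<open>auto simp: m_def\<close>)
    from add[OF base this[unfolded h_def]] show ?thesis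
      by (rule quartic_mono[OF idx])
        (use True q sorted in \<open>auto simp: ei_def ej_def m_def d_def algebra_simps\<close>)
  next
    case False
    have "h 0 (m + uk) (m + ul) (- uk - ul)"
      by (rule h) (use False sorted in \<open>auto simp: m_def\<close>)
    from add[OF base this[unfolded h_def]] show ?thesis
      by (rule quartic_mono[OF idx])
        (use False q sorted in \<open>auto simp: ei_def ej_def m_def d_def algebra_simps\<close>)
  qed
qed

lemma expressible_quartic_clipped:
  fixes ui uj uk ul A :: real
  assumes idx: "i < 4" "j < 4" "k < 4" "l < 4"
    and u: "\<bar>ui\<bar> \<le> A / 2" "\<bar>uj\<bar> \<le> A / 2" "\<bar>uk\<bar> \<le> A / 2" "\<bar>ul\<bar> \<le> A / 2"
    and q: "0 \<le> qij" "0 \<le> qik" "0 \<le> qil" "0 \<le> qjk" "0 \<le> qjl" "0 \<le> qkl"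
      "ui + uj \<le> qij" "ui + uk \<le> qik" "ui + ul \<le> qil"
      "uj + uk \<le> qjk" "uj + ul \<le> qjl" "uk + ul \<le> qkl"
  shows "expressible4 i j k l qij qik qil qjk qjl qkl (ui - A / 2) (uj - A / 2) (uk - A / 2) (ul - A / 2) A"
proof -
  have first: "expressible4 i j k l qij qik qil qjk qjl qkl (ui - A / 2) (uj - A / 2) (uk - A / 2) (ul - A / 2) A"
    if idx: "i < 4" "j < 4" "k < 4" "l < 4"
      and max: "\<bar>uj\<bar> \<le> \<bar>ui\<bar>" "\<bar>uk\<bar> \<le> \<bar>ui\<bar>" "\<bar>ul\<bar> \<le> \<bar>ui\<bar>" and A: "\<bar>ui\<bar> \<le> A / 2"
      and q: "0 \<le> qij" "0 \<le> qik" "0 \<le> qil" "0 \<le> qjk" "0 \<le> qjl" "0 \<le> qkl"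
        "ui + uj \<le> qij" "ui + uk \<le> qik" "ui + ul \<le> qil"
        "uj + uk \<le> qjk" "uj + ul \<le> qjl" "uk + ul \<le> qkl"
    for i j k l and qij qik qil qjk qjl qkl ui uj uk ul :: real
  proof -
    consider "\<bar>uk\<bar> \<le> \<bar>uj\<bar>" "\<bar>ul\<bar> \<le> \<bar>uj\<bar>" | "\<bar>uj\<bar> \<le> \<bar>uk\<bar>" "\<bar>ul\<bar> \<le> \<bar>uk\<bar>" | "\<bar>uj\<bar> \<le> \<bar>ul\<bar>" "\<bar>uk\<bar> \<le> \<bar>ul\<bar>"
      by linarith
    then show ?thesis
    proof cases
      case 1
      show ?thesis
        by (rule expressible_quartic_sorted) (use idx max A q 1 in auto)
    next
      case 2
      have "expressible4 i k j l qik qij qil qjk qkl qjl (ui - A / 2) (uk - A / 2) (uj - A / 2) (ul - A / 2) A"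
        by (rule expressible_quartic_sorted) (use idx max A q 2 in \<open>auto simp: add.commute\<close>)
      then show ?thesis
        by (rule expressible_cong) (simp add: quartic_def algebra_simps)
    next
      case 3
      have "expressible4 i l k j qil qik qij qkl qjl qjk (ui - A / 2) (ul - A / 2) (uk - A / 2) (uj - A / 2) A"
        by (rule expressible_quartic_sorted) (use idx max A q 3 in \<open>auto simp: add.commute\<close>)
      then show ?thesis
        by (rule expressible_cong) (simp add: quartic_def algebra_simps)
    qed
  qed
  consider "\<bar>uj\<bar> \<le> \<bar>ui\<bar>" "\<bar>uk\<bar> \<le> \<bar>ui\<bar>" "\<bar>ul\<bar> \<le> \<bar>ui\<bar>" | "\<bar>ui\<bar> \<le> \<bar>uj\<bar>" "\<bar>uk\<bar> \<le> \<bar>uj\<bar>" "\<bar>ul\<bar> \<le> \<bar>uj\<bar>"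
    | "\<bar>ui\<bar> \<le> \<bar>uk\<bar>" "\<bar>uj\<bar> \<le> \<bar>uk\<bar>" "\<bar>ul\<bar> \<le> \<bar>uk\<bar>" | "\<bar>ui\<bar> \<le> \<bar>ul\<bar>" "\<bar>uj\<bar> \<le> \<bar>ul\<bar>" "\<bar>uk\<bar> \<le> \<bar>ul\<bar>"
    by linarith
  then show ?thesis
  proof cases
    case 1
    show ?thesis
      by (rule first) (use idx u q 1 in auto)
  next
    case 2
    have "expressible4 j i k l qij qjk qjl qik qil qkl (uj - A / 2) (ui - A / 2) (uk - A / 2) (ul - A / 2) A"
      by (rule first) (use idx u q 2 in \<open>auto simp: add.commute\<close>)
    then show ?thesis
      by (rule expressible_cong) (simp add: quartic_def algebra_simps)
  next
    case 3
    have "expressible4 k j i l qjk qik qkl qij qjl qil (uk - A / 2) (uj - A / 2) (ui - A / 2) (ul - A / 2) A"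
      by (rule first) (use idx u q 3 in \<open>auto simp: add.commute\<close>)
    then show ?thesis
      by (rule expressible_cong) (simp add: quartic_def algebra_simps)
  next
    case 4
    have "expressible4 l j k i qjl qkl qil qjk qij qik (ul - A / 2) (uj - A / 2) (uk - A / 2) (ui - A / 2) A"
      by (rule first) (use idx u q 4 in \<open>auto simp: add.commute\<close>)
    then show ?thesis
      by (rule expressible_cong) (simp add: quartic_def algebra_simps)
  qed
qed

lemma expressible_quartic_nonneg:
  assumes idx: "i < 4" "j < 4" "k < 4" "l < 4" and A: "0 \<le> A"
    and q: "0 \<le> qij" "0 \<le> qik" "0 \<le> qil" "0 \<le> qjk" "0 \<le> qjl" "0 \<le> qkl"
    and b: "bi \<le> qij" "bi \<le> qik" "bi \<le> qil" "bj \<le> qij" "bj \<le> qjk" "bj \<le> qjl"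
      "bk \<le> qik" "bk \<le> qjk" "bk \<le> qkl" "bl \<le> qil" "bl \<le> qjl" "bl \<le> qkl"
    and bb: "bi + bj + A \<le> qij" "bi + bk + A \<le> qik" "bi + bl + A \<le> qil"
      "bj + bk + A \<le> qjk" "bj + bl + A \<le> qjl" "bk + bl + A \<le> qkl"
  shows "expressible4 i j k l qij qik qil qjk qjl qkl bi bj bk bl A"
proof -
  define r s :: "real \<Rightarrow> real" where "r b = max 0 b" and "s b = max 0 (- A - b)" for b
  define u where "u b = b - r b + s b + A / 2" for b
  have u: "\<bar>u b\<bar> \<le> A / 2" for b
    using A by (auto simp: u_def r_def s_def max_def abs_if field_simps)
  have surplus: "0 \<le> p - (r b + r b')" "u b + u b' \<le> p - (r b + r b')"
    if "0 \<le> p" "b \<le> p" "b' \<le> p" "b + b' + A \<le> p" for p b b'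
    using that A by (auto simp: u_def r_def s_def max_def)
  have "expressible4 i j k l (qij - (r bi + r bj)) (qik - (r bi + r bk)) (qil - (r bi + r bl))
      (qjk - (r bj + r bk)) (qjl - (r bj + r bl)) (qkl - (r bk + r bl))
      (u bi - A / 2) (u bj - A / 2) (u bk - A / 2) (u bl - A / 2) A"
    by (rule expressible_quartic_clipped; (rule idx u surplus)?) (use q b bb in auto)
  moreover have "expressible4 i j k l (r bi + r bj) (r bi + r bk) (r bi + r bl) (r bj + r bk) (r bj + r bl)
      (r bk + r bl) (r bi - s bi) (r bj - s bj) (r bk - s bk) (r bl - s bl) 0"
    by (rule quartic_triples[OF idx]) (simp_all add: r_def s_def)
  ultimately show ?thesis
    using quartic_add[OF idx] by (fastforce simp: u_def)
qed

section \<open>Necessity\<close>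

text \<open>A weight-preserving map of \<open>{0,1}\<^sup>5\<close> into itself that does not decrease inner products.
  It maps the columns of the list of pairs \<open>ij, ik, jk, il, jl\<close> to those of the list
  \<open>ijk, ijl, i, j, kl\<close>; it was found by computer search for such an extension.\<close>

definition sep1 :: "bool \<Rightarrow> bool \<Rightarrow> bool \<Rightarrow> bool \<Rightarrow> bool \<Rightarrow> bool" where
  "sep1 a b c d e \<longleftrightarrow> b \<or> c \<or> a \<and> (d \<or> e)"

definition sep2 :: "bool \<Rightarrow> bool \<Rightarrow> bool \<Rightarrow> bool \<Rightarrow> bool \<Rightarrow> bool" where
  "sep2 a b c d e \<longleftrightarrow> a \<or> d \<or> e"

definition sep3 :: "bool \<Rightarrow> bool \<Rightarrow> bool \<Rightarrow> bool \<Rightarrow> bool \<Rightarrow> bool" where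
  "sep3 a b c d e \<longleftrightarrow> a \<and> b \<and> d"

definition sep4 :: "bool \<Rightarrow> bool \<Rightarrow> bool \<Rightarrow> bool \<Rightarrow> bool \<Rightarrow> bool" where
  "sep4 a b c d e \<longleftrightarrow> c \<and> e \<and> (a \<or> b \<and> d)"

definition sep5 :: "bool \<Rightarrow> bool \<Rightarrow> bool \<Rightarrow> bool \<Rightarrow> bool \<Rightarrow> bool" where
  "sep5 a b c d e \<longleftrightarrow> b \<and> c \<or> d \<and> e \<or> a \<and> b \<and> e \<or> a \<and> c \<and> d"

lemmas sep_defs = sep1_def sep2_def sep3_def sep4_def sep5_def

lemma sep_weight:
  "of_bool (sep1 a b c d e) + of_bool (sep2 a b c d e) + of_bool (sep3 a b c d e)
     + of_bool (sep4 a b c d e) + of_bool (sep5 a b c d e)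
   = (of_bool a + of_bool b + of_bool c + of_bool d + of_bool e :: real)"
  by (cases a; cases b; cases c; cases d; cases e; simp add: sep_defs)

lemma sep_inner:
  "of_bool (a \<and> a') + of_bool (b \<and> b') + of_bool (c \<and> c') + of_bool (d \<and> d') + of_bool (e \<and> e')
   \<le> (of_bool (sep1 a b c d e \<and> sep1 a' b' c' d' e') + of_bool (sep2 a b c d e \<and> sep2 a' b' c' d' e')
     + of_bool (sep3 a b c d e \<and> sep3 a' b' c' d' e') + of_bool (sep4 a b c d e \<and> sep4 a' b' c' d' e')
     + of_bool (sep5 a b c d e \<and> sep5 a' b' c' d' e') :: real)"
  by (cases a; cases b; cases c; cases d; cases e;
      cases a'; cases b'; cases c'; cases d'; cases e'; simp add: sep_defs)

lemma sep_binary: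
  fixes \<phi> :: "bool \<Rightarrow> bool \<Rightarrow> real"
  assumes "\<phi> False False + \<phi> True True \<le> \<phi> False True + \<phi> True False"
  shows "\<phi> (sep1 a b c d e) (sep1 a' b' c' d' e') + \<phi> (sep2 a b c d e) (sep2 a' b' c' d' e')
      + \<phi> (sep3 a b c d e) (sep3 a' b' c' d' e') + \<phi> (sep4 a b c d e) (sep4 a' b' c' d' e')
      + \<phi> (sep5 a b c d e) (sep5 a' b' c' d' e')
    \<le> \<phi> a a' + \<phi> b b' + \<phi> c c' + \<phi> d d' + \<phi> e e'"
proof -
  define q where "q = \<phi> False False"
  define p r t where "p = \<phi> True False - \<phi> False False" and "r = \<phi> False True - \<phi> False False"
    and "t = \<phi> False True + \<phi> True False - \<phi> False False - \<phi> True True"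
  have rep: "\<phi> x y = q + p * of_bool x + r * of_bool y - t * of_bool (x \<and> y)" for x y
    by (cases x; cases y; simp add: q_def p_def r_def t_def)
  have sum: "\<phi> a a' + \<phi> b b' + \<phi> c c' + \<phi> d d' + \<phi> e e' = 5 * q
      + p * (of_bool a + of_bool b + of_bool c + of_bool d + of_bool e)
      + r * (of_bool a' + of_bool b' + of_bool c' + of_bool d' + of_bool e')
      - t * (of_bool (a \<and> a') + of_bool (b \<and> b') + of_bool (c \<and> c') + of_bool (d \<and> d')
          + of_bool (e \<and> e'))"
    for a a' b b' c c' d d' e e'
    unfolding rep[of a a'] rep[of b b'] rep[of c c'] rep[of d d'] rep[of e e']
    by (simp only: distrib_left)
  have "0 \<le> t"
    using assms by (simp add: t_def)
  from mult_left_mono[OF sep_inner this] show ?thesis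
    unfolding sum sep_weight by simp
qed

definition map5 :: "(bool \<Rightarrow> bool \<Rightarrow> bool \<Rightarrow> bool \<Rightarrow> bool \<Rightarrow> bool) \<Rightarrow>
    bool list \<Rightarrow> bool list \<Rightarrow> bool list \<Rightarrow> bool list \<Rightarrow> bool list \<Rightarrow> bool list" where
  "map5 h u v w x y = map (\<lambda>m. h (u ! m) (v ! m) (w ! m) (x ! m) (y ! m)) [0..<length u]"

lemma map5_in_cube: "u \<in> cube n \<Longrightarrow> map5 h u v w x y \<in> cube n"
  by (simp add: cube_def map5_def)

lemma map5_append:
  assumes "u \<in> cube n" "v \<in> cube n" "w \<in> cube n" "x \<in> cube n" "y \<in> cube n"
    and "u' \<in> cube m"
  shows "map5 h (u @ u') (v @ v') (w @ w') (x @ x') (y @ y') = map5 h u v w x y @ map5 h u' v' w' x' y'"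
  by (rule nth_equalityI) (use assms in \<open>auto simp: map5_def cube_def nth_append\<close>)

lemma Gamma_sub2_sep:
  assumes "(length s, g) \<in> Gamma_sub2" and "set s \<subseteq> {..<n}" and "u \<in> cube n"
  shows "g (map ((!) (map5 sep1 u v w x y)) s) + g (map ((!) (map5 sep2 u v w x y)) s)
      + g (map ((!) (map5 sep3 u v w x y)) s) + g (map ((!) (map5 sep4 u v w x y)) s)
      + g (map ((!) (map5 sep5 u v w x y)) s)
    \<le> g (map ((!) u) s) + g (map ((!) v) s) + g (map ((!) w) s) + g (map ((!) x) s)
      + g (map ((!) y) s)"
proof -
  have nth: "map5 h u v w x y ! m = h (u ! m) (v ! m) (w ! m) (x ! m) (y ! m)" if "m < n" for h m
    using that assms(3) by (simp add: map5_def cube_def)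
  have "length s \<le> 2"
    using assms(1) by (simp add: Gamma_sub2_def)
  then consider "s = []" | m where "s = [m]" | m m' where "s = [m, m']"
    by (metis (no_types, lifting) One_nat_def Suc_1 le_Suc_eq le_zero_eq length_0_conv length_Suc_conv)
  then show ?thesis
  proof cases
    case 1
    then show ?thesis by simp
  next
    case (2 m)
    then have "m < n" using assms(2) by simp
    with 2 show ?thesis
      using sep_binary[of "\<lambda>a _. g [a]"] by (simp add: nth)
  next
    case (3 m m')
    then have "m < n" "m' < n" using assms(2) by simp_all
    moreover have "g [False, False] + g [True, True] \<le> g [False, True] + g [True, False]"
      using assms(1) 3 by (simp add: binary_in_Gamma_sub2_iff[unfolded numeral_2_eq_2])
    ultimately show ?thesis
      using 3 sep_binary[of "\<lambda>a b. g [a, b]"] by (simp add: nth)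
  qed
qed

lemma nonneg_combination_sep:
  assumes "nonneg_combination Gamma_sub2 n \<phi>"
    and z: "u \<in> cube n" "v \<in> cube n" "w \<in> cube n" "x \<in> cube n" "y \<in> cube n"
  shows "\<phi> (map5 sep1 u v w x y) + \<phi> (map5 sep2 u v w x y) + \<phi> (map5 sep3 u v w x y)
      + \<phi> (map5 sep4 u v w x y) + \<phi> (map5 sep5 u v w x y) \<le> \<phi> u + \<phi> v + \<phi> w + \<phi> x + \<phi> y"
proof -
  obtain N :: nat and c :: "nat \<Rightarrow> real" and g :: "nat \<Rightarrow> bool list \<Rightarrow> real"
    and s :: "nat \<Rightarrow> nat list"
    where c: "\<And>t. t < N \<Longrightarrow> 0 \<le> c t \<and> (length (s t), g t) \<in> Gamma_sub2 \<and> set (s t) \<subseteq> {..<n}"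
      and \<phi>: "\<And>z. z \<in> cube n \<Longrightarrow> \<phi> z = (\<Sum>t<N. c t * g t (map ((!) z) (s t)))"
    using assms(1) by (rule nonneg_combinationE) (rule that)
  show ?thesis
    unfolding \<phi>[OF map5_in_cube[OF z(1)]] z[THEN \<phi>] sum.distrib[symmetric] distrib_left[symmetric]
    using c z(1) by (intro sum_mono mult_left_mono Gamma_sub2_sep) auto
qed

lemma expressible_sep:
  assumes "expressible Gamma_sub2 n f"
    and x: "x1 \<in> cube n" "x2 \<in> cube n" "x3 \<in> cube n" "x4 \<in> cube n" "x5 \<in> cube n"
  shows "f (map5 sep1 x1 x2 x3 x4 x5) + f (map5 sep2 x1 x2 x3 x4 x5) + f (map5 sep3 x1 x2 x3 x4 x5)
      + f (map5 sep4 x1 x2 x3 x4 x5) + f (map5 sep5 x1 x2 x3 x4 x5)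
    \<le> f x1 + f x2 + f x3 + f x4 + f x5"
proof -
  obtain j \<kappa> \<phi> where \<phi>: "nonneg_combination Gamma_sub2 (n + j) \<phi>"
    and attained: "\<And>x. x \<in> cube n \<Longrightarrow> \<exists>y\<in>cube j. f x = \<phi> (x @ y) + \<kappa>"
    and lower: "\<And>x y. x \<in> cube n \<Longrightarrow> y \<in> cube j \<Longrightarrow> f x \<le> \<phi> (x @ y) + \<kappa>"
    using assms(1) unfolding expressible_iff_attained by blast
  obtain y1 where y1: "y1 \<in> cube j" "f x1 = \<phi> (x1 @ y1) + \<kappa>" using attained[OF x(1)] by blast
  obtain y2 where y2: "y2 \<in> cube j" "f x2 = \<phi> (x2 @ y2) + \<kappa>" using attained[OF x(2)] by blast
  obtain y3 where y3: "y3 \<in> cube j" "f x3 = \<phi> (x3 @ y3) + \<kappa>" using attained[OF x(3)] by blast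
  obtain y4 where y4: "y4 \<in> cube j" "f x4 = \<phi> (x4 @ y4) + \<kappa>" using attained[OF x(4)] by blast
  obtain y5 where y5: "y5 \<in> cube j" "f x5 = \<phi> (x5 @ y5) + \<kappa>" using attained[OF x(5)] by blast
  have append: "x @ y \<in> cube (n + j)" if "x \<in> cube n" "y \<in> cube j" for x y
    using that by (simp add: cube_def)
  have f: "f (map5 h x1 x2 x3 x4 x5) \<le> \<phi> (map5 h (x1 @ y1) (x2 @ y2) (x3 @ y3) (x4 @ y4) (x5 @ y5)) + \<kappa>" for h
    unfolding map5_append[OF x y1(1)]
    by (rule lower; rule map5_in_cube) (rule x y1)+
  show ?thesis
    using f[of sep1] f[of sep2] f[of sep3] f[of sep4] f[of sep5] y1(2) y2(2) y3(2) y4(2) y5(2)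
      nonneg_combination_sep[OF \<phi> append[OF x(1) y1(1)] append[OF x(2) y2(1)] append[OF x(3) y3(1)]
        append[OF x(4) y4(1)] append[OF x(5) y5(1)]]
    by linarith
qed

section \<open>Coefficients\<close>

definition indicator_list :: "nat \<Rightarrow> nat set \<Rightarrow> bool list" where
  "indicator_list n S = map (\<lambda>m. m \<in> S) [0..<n]"

lemma indicator_list_in_cube: "indicator_list n S \<in> cube n"
  by (simp add: indicator_list_def cube_def)

lemma polynomial_representation_indicator:
  assumes "polynomial_representation n a f" and "S \<subseteq> {..<n}"
  shows "f (indicator_list n S) = sum a (Pow S)"
proof -
  have "f (indicator_list n S)
      = (\<Sum>I\<in>Pow {..<n}. a I * (\<Prod>i\<in>I. of_bool (indicator_list n S ! i)))"
    using assms(1) indicator_list_in_cube unfolding polynomial_representation_def by blast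
  also have "\<dots> = (\<Sum>I\<in>Pow {..<n}. if I \<subseteq> S then a I else 0)"
  proof (rule sum.cong[OF refl])
    fix I assume I: "I \<in> Pow {..<n}"
    then have "(\<Prod>i\<in>I. of_bool (indicator_list n S ! i)) = (\<Prod>i\<in>I. of_bool (i \<in> S) :: real)"
      by (intro prod.cong) (auto simp: indicator_list_def)
    also have "\<dots> = of_bool (I \<subseteq> S)"
      using finite_subset[of I "{..<n}"] I by (auto simp: subset_eq)
    finally show "a I * (\<Prod>i\<in>I. of_bool (indicator_list n S ! i)) = (if I \<subseteq> S then a I else 0)"
      by simp
  qed
  also have "\<dots> = sum a (Pow S)"
    using assms(2) by (intro sum.mono_neutral_cong_right) auto
  finally show ?thesis .
qed

lemma sum_Pow_insert:
  fixes a :: "'a set \<Rightarrow> real"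
  assumes "finite S" and "x \<notin> S"
  shows "sum a (Pow (insert x S)) = sum a (Pow S) + (\<Sum>I\<in>Pow S. a (insert x I))"
proof -
  have "sum a (Pow (insert x S)) = sum a (Pow S) + sum a (insert x ` Pow S)"
    unfolding Pow_insert using assms by (intro sum.union_disjoint) auto
  also have "sum a (insert x ` Pow S) = (\<Sum>I\<in>Pow S. a (insert x I))"
    using assms(2) by (subst sum.reindex) (auto simp: inj_on_def)
  finally show ?thesis .
qed

lemma submodular_coefficients:
  assumes "submodular n f" and "polynomial_representation n a f"
    and S: "S \<subseteq> {..<n}" "i < n" "j < n" "i \<noteq> j" "i \<notin> S" "j \<notin> S"
  shows "(\<Sum>I\<in>Pow S. a (insert i (insert j I))) \<le> 0"
proof -
  let ?f = "\<lambda>S. f (indicator_list n S)"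
  have "map2 min (indicator_list n (insert i S)) (indicator_list n (insert j S)) = indicator_list n S"
    "map2 max (indicator_list n (insert i S)) (indicator_list n (insert j S))
      = indicator_list n (insert i (insert j S))"
    using S by (auto simp: indicator_list_def list_eq_iff_nth_eq min_def max_def)
  then have "?f S + ?f (insert i (insert j S)) \<le> ?f (insert i S) + ?f (insert j S)"
    using assms(1) indicator_list_in_cube unfolding submodular_def by metis
  moreover have "finite S"
    using S(1) by (rule finite_subset) simp
  ultimately show ?thesis
    using S by (simp add: polynomial_representation_indicator[OF assms(2)] sum_Pow_insert)
qed

lemma expressible_imp_Sep:
  assumes "polynomial_representation 4 a f" and "expressible Gamma_sub2 4 f"
  shows "Sep a"
  unfolding Sep_def
proof (intro ballI impI)
  fix i j k l :: nat
  assume idx: "i \<in> {..<4}" "j \<in> {..<4}" "k \<in> {..<4}" "l \<in> {..<4}" and dist: "distinct [i, j, k, l]"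
  let ?x = "indicator_list 4"
  have all: "m < 4 \<longleftrightarrow> m \<in> {i, j, k, l}" for m
  proof -
    have "{i, j, k, l} = {..<4}"
      using idx dist by (intro card_subset_eq) auto
    then show ?thesis by (metis lessThan_iff)
  qed
  have sep: "map5 h (?x {i, j}) (?x {i, k}) (?x {j, k}) (?x {i, l}) (?x {j, l}) = ?x S"
    if "\<And>m. m \<in> {i, j, k, l} \<Longrightarrow> h (m \<in> {i, j}) (m \<in> {i, k}) (m \<in> {j, k}) (m \<in> {i, l}) (m \<in> {j, l}) = (m \<in> S)"
    for h S
    using that by (simp add: map5_def indicator_list_def all)
  have "map5 sep1 (?x {i, j}) (?x {i, k}) (?x {j, k}) (?x {i, l}) (?x {j, l}) = ?x {i, j, k}"
    "map5 sep2 (?x {i, j}) (?x {i, k}) (?x {j, k}) (?x {i, l}) (?x {j, l}) = ?x {i, j, l}"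
    "map5 sep3 (?x {i, j}) (?x {i, k}) (?x {j, k}) (?x {i, l}) (?x {j, l}) = ?x {i}"
    "map5 sep4 (?x {i, j}) (?x {i, k}) (?x {j, k}) (?x {i, l}) (?x {j, l}) = ?x {j}"
    "map5 sep5 (?x {i, j}) (?x {i, k}) (?x {j, k}) (?x {i, l}) (?x {j, l}) = ?x {k, l}"
    by (rule sep; use dist in \<open>auto simp: sep_defs\<close>)+
  with expressible_sep[OF assms(2), of "?x {i, j}" "?x {i, k}" "?x {j, k}" "?x {i, l}" "?x {j, l}"]
  have "f (?x {i, j, k}) + f (?x {i, j, l}) + f (?x {i}) + f (?x {j}) + f (?x {k, l})
    \<le> f (?x {i, j}) + f (?x {i, k}) + f (?x {j, k}) + f (?x {i, l}) + f (?x {j, l})"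
    by (simp add: indicator_list_in_cube)
  then show "a {i, j} + a {k, l} + a {i, j, k} + a {i, j, l} \<le> 0"
    using idx dist
    by (simp add: polynomial_representation_indicator[OF assms(1)] sum_Pow_insert)
qed

lemma Sep_imp_expressible:
  assumes "submodular 4 f" and rep: "polynomial_representation 4 a f" and "Sep a"
  shows "expressible Gamma_sub2 4 f"
proof -
  note sub = submodular_coefficients[OF assms(1,2)]
  have pairs: "a {0, 1} \<le> 0" "a {0, 2} \<le> 0" "a {0, 3} \<le> 0" "a {1, 2} \<le> 0" "a {1, 3} \<le> 0" "a {2, 3} \<le> 0"
    using sub[of "{}" 0 1] sub[of "{}" 0 2] sub[of "{}" 0 3] sub[of "{}" 1 2] sub[of "{}" 1 3] sub[of "{}" 2 3]
    by simp_all
  have triples: "a {0, 1} + a {0, 1, 2} \<le> 0" "a {0, 2} + a {0, 1, 2} \<le> 0" "a {1, 2} + a {0, 1, 2} \<le> 0"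
    "a {0, 1} + a {0, 1, 3} \<le> 0" "a {0, 3} + a {0, 1, 3} \<le> 0" "a {1, 3} + a {0, 1, 3} \<le> 0"
    "a {0, 2} + a {0, 2, 3} \<le> 0" "a {0, 3} + a {0, 2, 3} \<le> 0" "a {2, 3} + a {0, 2, 3} \<le> 0"
    "a {1, 2} + a {1, 2, 3} \<le> 0" "a {1, 3} + a {1, 2, 3} \<le> 0" "a {2, 3} + a {1, 2, 3} \<le> 0"
    using sub[of "{2}" 0 1] sub[of "{1}" 0 2] sub[of "{0}" 1 2]
      sub[of "{3}" 0 1] sub[of "{1}" 0 3] sub[of "{0}" 1 3]
      sub[of "{3}" 0 2] sub[of "{2}" 0 3] sub[of "{0}" 2 3]
      sub[of "{3}" 1 2] sub[of "{2}" 1 3] sub[of "{1}" 2 3]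
    by (simp_all add: sum_Pow_insert insert_commute)
  have quads: "a {0, 1} + a {0, 1, 2} + a {0, 1, 3} + a {0, 1, 2, 3} \<le> 0"
    "a {0, 2} + a {0, 1, 2} + a {0, 2, 3} + a {0, 1, 2, 3} \<le> 0"
    "a {0, 3} + a {0, 1, 3} + a {0, 2, 3} + a {0, 1, 2, 3} \<le> 0"
    "a {1, 2} + a {0, 1, 2} + a {1, 2, 3} + a {0, 1, 2, 3} \<le> 0"
    "a {1, 3} + a {0, 1, 3} + a {1, 2, 3} + a {0, 1, 2, 3} \<le> 0"
    "a {2, 3} + a {0, 2, 3} + a {1, 2, 3} + a {0, 1, 2, 3} \<le> 0"
    using sub[of "{2, 3}" 0 1] sub[of "{1, 3}" 0 2] sub[of "{1, 2}" 0 3]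
      sub[of "{0, 3}" 1 2] sub[of "{0, 2}" 1 3] sub[of "{0, 1}" 2 3]
    by (simp_all add: sum_Pow_insert insert_commute)
  have Sep: "a {i, j} + a {k, l} + a {i, j, k} + a {i, j, l} \<le> 0"
    if "i < 4" "j < 4" "k < 4" "l < 4" "distinct [i, j, k, l]" for i j k l
    using assms(3) that unfolding Sep_def by blast
  have seps: "a {0, 1} + a {2, 3} + a {0, 1, 2} + a {0, 1, 3} \<le> 0"
    "a {0, 2} + a {1, 3} + a {0, 1, 2} + a {0, 2, 3} \<le> 0"
    "a {0, 3} + a {1, 2} + a {0, 1, 3} + a {0, 2, 3} \<le> 0"
    "a {1, 2} + a {0, 3} + a {0, 1, 2} + a {1, 2, 3} \<le> 0"
    "a {1, 3} + a {0, 2} + a {0, 1, 3} + a {1, 2, 3} \<le> 0"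
    "a {2, 3} + a {0, 1} + a {0, 2, 3} + a {1, 2, 3} \<le> 0"
    using Sep[of 0 1 2 3] Sep[of 0 2 1 3] Sep[of 0 3 1 2] Sep[of 1 2 0 3] Sep[of 1 3 0 2] Sep[of 2 3 0 1]
    by (simp_all add: insert_commute)
  have quartic: "expressible Gamma_sub2 4 (quartic 0 1 2 3 (- a {2, 3}) (- a {1, 3}) (- a {1, 2})
      (- a {0, 3}) (- a {0, 2}) (- a {0, 1}) (a {1, 2, 3}) (a {0, 2, 3}) (a {0, 1, 3}) (a {0, 1, 2})
      (a {0, 1, 2, 3}))"
  proof (cases "0 \<le> a {0, 1, 2, 3}")
    case True
    show ?thesis
      by (rule expressible_quartic_nonneg) (use True pairs triples quads in simp_all)
  next
    case False
    show ?thesis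
      by (rule expressible_quartic_nonpos) (use False pairs triples quads seps in simp_all)
  qed
  have lessThan4: "{..<4} = {0, 1, 2, 3 :: nat}"
    by auto
  from expressible_add[OF expressible_modular[of "a {}" "a {0}" "a {1}" "a {2}" "a {3}"] quartic]
  show ?thesis
  proof (rule expressible_cong)
    fix x :: "bool list" assume "x \<in> cube 4"
    then have "f x = (\<Sum>I\<in>Pow {..<4}. a I * (\<Prod>i\<in>I. coord x i))"
      using rep unfolding polynomial_representation_def by blast
    then show "f x = a {} + a {0} * coord x 0 + a {1} * coord x 1 + a {2} * coord x 2 + a {3} * coord x 3
        + quartic 0 1 2 3 (- a {2, 3}) (- a {1, 3}) (- a {1, 2}) (- a {0, 3}) (- a {0, 2}) (- a {0, 1})
          (a {1, 2, 3}) (a {0, 2, 3}) (a {0, 1, 3}) (a {0, 1, 2}) (a {0, 1, 2, 3}) x"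
      by (simp add: lessThan4 sum_Pow_insert quartic_def)
  qed
qed

theorem theorem4:
  fixes f :: "bool list \<Rightarrow> real" and a :: "nat set \<Rightarrow> real"
  assumes "submodular 4 f"
    and "polynomial_representation 4 a f"
  shows "expressible Gamma_sub2 4 f \<longleftrightarrow> Sep a"
  using expressible_imp_Sep[OF assms(2)] Sep_imp_expressible[OF assms] by blast

end
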